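(* Let $[Q]$ be a toric poset on a vertex set $V=[n]$, and let $G$ be the underlying undirected graph of $[Q]$. If either $G$ is disconnected and has at least three vertices, or $G$ has a cut vertex, then $\Psi_{\rm tor}^{[Q]}(\mathbf{x})=0$ as a rational function.
   Context: All quivers are finite directed graphs that are simple (no loops, no parallel or anti-parallel arcs) and acyclic (no directed cycles), on a vertex set $V=[n]=\{1,\dots,n\}$. A source is a vertex all of whose incident arcs point away from it; a sink is a vertex all of whose incident arcs point into it (an isolated vertex is both). A flip at a source or sink $k$ reverses all arcs incident to $k$. Two acyclic quivers are equivalent if they are related by a finite sequence of flips; the equivalence class $[Q]$ of $Q$ is called a toric poset. All members of $[Q]$ have the same underlying undirected graph, called the underlying graph of $[Q]$. A cut vertex of a graph is a vertex whose removal increases the number of connected components. A toric total order $[w]=[(w_1,\dots,w_n)]$ is the equivalence class of a permutation $(w_1,\dots,w_n)$ of $V$ under cyclic rotation $(w_1,\dots,w_n)\mapsto(w_2,\dots,w_n,w_1)$. For a graph $G$ on $V$, let $\mathcal{A}_{\rm tor}(G)$ be the image in $\mathbb{R}^n/\mathbb{Z}^n$ of $\bigcup_{\{i,j\}\in G}\{x_i=x_j\}\subset\mathbb{R}^n$. A point of $\mathbb{R}^n/\mathbb{Z}^n-\mathcal{A}_{\rm tor}(G)$ determines an acyclic orientation of $G$: $i\to j$ if $x_i \bmod 1< x_j \bmod 1$ (values in $[0,1)$), and $j\to i$ otherwise. For a toric poset $[Q]$ with underlying graph $G$, its toric chamber $c_{[Q]}$ is the set of points whose orientation lies in $[Q]$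 (these sets are exactly the connected components of $\mathbb{R}^n/\mathbb{Z}^n-\mathcal{A}_{\rm tor}(G)$). For a toric total order $[w]$, $c_{[w]}$ is the set of points with pairwise distinct coordinates such that listing the indices in increasing order of $x_i\bmod 1$ gives a member of $[w]$. $[w]$ is a toric total extension of $[Q]$ if $c_{[w]}\subseteq c_{[Q]}$; the set of these is $\mathcal{L}_{\rm tor}([Q])$. Define $\Psi_{\rm tor}^{[Q]}(\mathbf{x})=\sum_{[w]\in\mathcal{L}_{\rm tor}([Q])}\Psi_{\rm tor}^{[w]}(\mathbf{x})$, where $\Psi_{\rm tor}^{[w]}(\mathbf{x})=\dfrac{1}{(x_{w_1}-x_{w_2})(x_{w_2}-x_{w_3})\cdots(x_{w_{n-1}}-x_{w_n})(x_{w_n}-x_{w_1})}$ and $\mathbf{x}=(x_1,\dots,x_n)$ are indeterminates. *)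

theory Defs
  imports
    Complex_Main
    "HOL-Library.FuncSet"
    "HOL-Library.Poly_Mapping"
    "HOL-Computational_Algebra.Fraction_Field"
    "HOL-Combinatorics.Multiset_Permutations"
begin

section \<open>Undirected graphs\<close>

text \<open>A graph is given by a vertex set and a set of two-element edges. Edges with an end
  outside \<open>V\<close> are ignored, so that \<open>graph_reach (V - {v}) E\<close> is reachability after removal of
  the vertex \<open>v\<close>.\<close>

definition graph_reach :: "'v set \<Rightarrow> 'v set set \<Rightarrow> ('v \<times> 'v) set" where
  "graph_reach V E =
     {(u, v). u \<in> V \<and> v \<in> V \<and> (u, v) \<in> {(a, b). a \<in> V \<and> b \<in> V \<and> {a, b} \<in> E}\<^sup>*}"

definition graph_components :: "'v set \<Rightarrow> 'v set set \<Rightarrow> 'v set set" where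
  "graph_components V E = V // graph_reach V E"

definition graph_connected :: "'v set \<Rightarrow> 'v set set \<Rightarrow> bool" where
  "graph_connected V E \<longleftrightarrow> (\<forall>u\<in>V. \<forall>v\<in>V. (u, v) \<in> graph_reach V E)"

definition cut_vertex :: "'v set \<Rightarrow> 'v set set \<Rightarrow> 'v \<Rightarrow> bool" where
  "cut_vertex V E v \<longleftrightarrow>
     v \<in> V \<and> card (graph_components (V - {v}) E) > card (graph_components V E)"

lemma equiv_graph_reach: "equiv V (graph_reach V E)"
proof (rule equivI)
  show "graph_reach V E \<subseteq> V \<times> V" by (auto simp: graph_reach_def)
  show "refl_on V (graph_reach V E)" by (auto simp: refl_on_def graph_reach_def)
  have "sym ({(a, b). a \<in> V \<and> b \<in> V \<and> {a, b} \<in> E}\<^sup>*)"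
    by (intro sym_rtrancl symI) (simp add: doubleton_eq_iff insert_commute)
  then show "sym (graph_reach V E)" by (auto simp: sym_def graph_reach_def)
  show "trans (graph_reach V E)"
    by (rule transI) (auto simp: graph_reach_def intro: rtrancl_trans)
qed


section \<open>Quivers, flips and toric posets\<close>

text \<open>A quiver on \<open>{1..n}\<close> is its set of arcs; parallel arcs are thereby excluded.\<close>

definition quivers :: "nat \<Rightarrow> (nat \<times> nat) set set" where
  "quivers n = {Q. Q \<subseteq> {1..n} \<times> {1..n} \<and> irrefl Q \<and>
     (\<forall>i j. (i, j) \<in> Q \<longrightarrow> (j, i) \<notin> Q) \<and> acyclic Q}"

definition is_source :: "(nat \<times> nat) set \<Rightarrow> nat \<Rightarrow> bool" where
  "is_source Q k \<longleftrightarrow> (\<forall>i. (i, k) \<notin> Q)"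

definition is_sink :: "(nat \<times> nat) set \<Rightarrow> nat \<Rightarrow> bool" where
  "is_sink Q k \<longleftrightarrow> (\<forall>j. (k, j) \<notin> Q)"

definition flip :: "nat \<Rightarrow> (nat \<times> nat) set \<Rightarrow> (nat \<times> nat) set" where
  "flip k Q = {(i, j). if k \<in> {i, j} then (j, i) \<in> Q else (i, j) \<in> Q}"

definition flip_step :: "nat \<Rightarrow> ((nat \<times> nat) set \<times> (nat \<times> nat) set) set" where
  "flip_step n = {(Q, flip k Q) | Q k. Q \<in> quivers n \<and> k \<in> {1..n} \<and> (is_source Q k \<or> is_sink Q k)}"

definition flip_equiv :: "nat \<Rightarrow> ((nat \<times> nat) set \<times> (nat \<times> nat) set) set" where
  "flip_equiv n = {(Q, Q'). Q \<in> quivers n \<and> Q' \<in> quivers n \<and> (Q, Q') \<in> (flip_step n)\<^sup>*}"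

definition toric_posets :: "nat \<Rightarrow> (nat \<times> nat) set set set" where
  "toric_posets n = quivers n // flip_equiv n"

definition quiver_graph :: "(nat \<times> nat) set \<Rightarrow> nat set set" where
  "quiver_graph Q = {{i, j} | i j. (i, j) \<in> Q}"

text \<open>All members of a toric poset have the same underlying graph, see
  \<open>underlying_graph_eq\<close> below.\<close>

definition underlying_graph :: "(nat \<times> nat) set set \<Rightarrow> nat set set" where
  "underlying_graph P = the_elem (quiver_graph ` P)"

lemma flip_flip [simp]: "flip k (flip k Q) = Q"
  by (auto simp: flip_def)

lemma is_source_flip [simp]: "is_source (flip k Q) k \<longleftrightarrow> is_sink Q k"
  and is_sink_flip [simp]: "is_sink (flip k Q) k \<longleftrightarrow> is_source Q k"
  by (auto simp: flip_def is_source_def is_sink_def)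

lemma acyclic_if_sink:
  assumes "is_sink R k" and "acyclic {(i, j) \<in> R. i \<noteq> k \<and> j \<noteq> k}"
  shows "acyclic R"
proof -
  have *: "(a, b) \<in> {(i, j) \<in> R. i \<noteq> k \<and> j \<noteq> k}\<^sup>+" if "(a, b) \<in> R\<^sup>+" "b \<noteq> k" for a b
    using that
  proof (induction rule: trancl_induct)
    case (base b)
    then show ?case using assms(1) by (auto simp: is_sink_def)
  next
    case (step b c)
    then have "b \<noteq> k" using assms(1) by (auto simp: is_sink_def)
    then have "(b, c) \<in> {(i, j) \<in> R. i \<noteq> k \<and> j \<noteq> k}" using step by auto
    then show ?case using step.IH \<open>b \<noteq> k\<close> by (meson trancl_into_trancl)
  qed
  show ?thesis
  proof (rule acyclicI, intro allI notI)
    fix a assume a: "(a, a) \<in> R\<^sup>+"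
    then have "a \<noteq> k" using assms(1) by (auto simp: is_sink_def dest: tranclD)
    then show False using * a assms(2) by (auto simp: acyclic_def)
  qed
qed

lemma flip_quivers:
  assumes Q: "Q \<in> quivers n" and k: "is_source Q k \<or> is_sink Q k"
  shows "flip k Q \<in> quivers n"
proof -
  have sub: "acyclic {(i, j) \<in> R. i \<noteq> k \<and> j \<noteq> k}" if "acyclic R" for R :: "(nat \<times> nat) set"
    using that by (rule acyclic_subset) auto
  have src: "acyclic (flip k R)" if "acyclic R" "is_source R k" for R
  proof (rule acyclic_if_sink)
    show "is_sink (flip k R) k" using that by simp
    have "{(i, j) \<in> flip k R. i \<noteq> k \<and> j \<noteq> k} = {(i, j) \<in> R. i \<noteq> k \<and> j \<noteq> k}"
      by (auto simp: flip_def)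
    then show "acyclic {(i, j) \<in> flip k R. i \<noteq> k \<and> j \<noteq> k}" using sub that by simp
  qed
  have "acyclic (flip k Q)"
  proof (cases "is_source Q k")
    case True
    then show ?thesis using src Q by (auto simp: quivers_def)
  next
    case False
    then have "is_source (Q\<inverse>) k" using k by (simp add: is_source_def is_sink_def) blast
    moreover have "acyclic (Q\<inverse>)" using Q by (simp add: quivers_def acyclic_converse)
    ultimately have "acyclic (flip k (Q\<inverse>))" by (intro src)
    moreover have "flip k (Q\<inverse>) = (flip k Q)\<inverse>" by (auto simp: flip_def)
    ultimately show ?thesis by (simp add: acyclic_converse)
  qed
  moreover have "flip k Q \<subseteq> {1..n} \<times> {1..n}"
    using Q unfolding quivers_def flip_def by (force split: if_splits)
  moreover have "(j, i) \<notin> flip k Q" if "(i, j) \<in> flip k Q" for i j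
    using Q that unfolding quivers_def flip_def by (simp split: if_splits)
  moreover have "irrefl (flip k Q)"
    using Q unfolding quivers_def flip_def irrefl_def by simp
  ultimately show ?thesis by (simp add: quivers_def)
qed

lemma equiv_flip_equiv: "equiv (quivers n) (flip_equiv n)"
proof (rule equivI)
  show "flip_equiv n \<subseteq> quivers n \<times> quivers n" by (auto simp: flip_equiv_def)
  show "refl_on (quivers n) (flip_equiv n)" by (auto simp: refl_on_def flip_equiv_def)
  have "sym (flip_step n)"
  proof (rule symI)
    fix Q Q' assume "(Q, Q') \<in> flip_step n"
    then obtain k where k: "Q' = flip k Q" "Q \<in> quivers n" "k \<in> {1..n}"
      "is_source Q k \<or> is_sink Q k" by (auto simp: flip_step_def)
    have "Q = flip k Q'" unfolding k(1) by simp
    moreover have "Q' \<in> quivers n" unfolding k(1) by (rule flip_quivers[OF k(2,4)])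
    moreover have "is_source Q' k \<or> is_sink Q' k" using k(4) unfolding k(1) by auto
    ultimately show "(Q', Q) \<in> flip_step n" using k(3) unfolding flip_step_def by blast
  qed
  then have "sym ((flip_step n)\<^sup>*)" by (rule sym_rtrancl)
  then show "sym (flip_equiv n)" unfolding sym_def flip_equiv_def by blast
  show "trans (flip_equiv n)"
  proof (rule transI)
    fix Q Q' Q'' assume "(Q, Q') \<in> flip_equiv n" "(Q', Q'') \<in> flip_equiv n"
    then show "(Q, Q'') \<in> flip_equiv n"
      unfolding flip_equiv_def using rtrancl_trans[of Q Q' "flip_step n" Q''] by simp
  qed
qed

lemma quiver_graph_flip [simp]: "quiver_graph (flip k Q) = quiver_graph Q"
proof -
  have sub: "quiver_graph (flip k R) \<subseteq> quiver_graph R" for R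
  proof
    fix e assume "e \<in> quiver_graph (flip k R)"
    then obtain i j where e: "e = {i, j}" "(i, j) \<in> flip k R" by (auto simp: quiver_graph_def)
    then have "(i, j) \<in> R \<or> (j, i) \<in> R" by (auto simp: flip_def split: if_splits)
    then show "e \<in> quiver_graph R" using e(1) unfolding quiver_graph_def by blast
  qed
  from sub[of Q] sub[of "flip k Q"] show ?thesis by simp
qed

lemma quiver_graph_flip_equiv:
  assumes "(Q, Q') \<in> flip_equiv n"
  shows "quiver_graph Q' = quiver_graph Q"
proof -
  have "(Q, Q') \<in> (flip_step n)\<^sup>*" using assms by (simp add: flip_equiv_def)
  then show ?thesis
  proof (induction rule: rtrancl_induct)
    case (step R R')
    then obtain k where "R' = flip k R" unfolding flip_step_def by blast
    then have "quiver_graph R' = quiver_graph R" by (simp only: quiver_graph_flip)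
    then show ?case using step.IH by (rule trans)
  qed (rule refl)
qed

lemma underlying_graph_eq:
  assumes "P \<in> toric_posets n" "Q \<in> P"
  shows "underlying_graph P = quiver_graph Q"
proof -
  have "quiver_graph Q' = quiver_graph Q" if "Q' \<in> P" for Q'
  proof -
    have "(Q, Q') \<in> flip_equiv n"
      using quotient_eq_iff[OF equiv_flip_equiv _ _ assms(2) that] assms(1)
      unfolding toric_posets_def by blast
    then show ?thesis by (rule quiver_graph_flip_equiv)
  qed
  then have "quiver_graph ` P = {quiver_graph Q}" using assms(2) by blast
  then show ?thesis by (simp add: underlying_graph_def)
qed


section \<open>The torus and toric chambers\<close>

definition real_space :: "nat \<Rightarrow> (nat \<Rightarrow> real) set" where
  "real_space n = {1..n} \<rightarrow>\<^sub>E UNIV"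

definition torus_rel :: "nat \<Rightarrow> ((nat \<Rightarrow> real) \<times> (nat \<Rightarrow> real)) set" where
  "torus_rel n = {(x, y). x \<in> real_space n \<and> y \<in> real_space n \<and> (\<forall>i\<in>{1..n}. x i - y i \<in> \<int>)}"

definition torus :: "nat \<Rightarrow> (nat \<Rightarrow> real) set set" where
  "torus n = real_space n // torus_rel n"

definition torus_proj :: "nat \<Rightarrow> (nat \<Rightarrow> real) \<Rightarrow> (nat \<Rightarrow> real) set" where
  "torus_proj n x = torus_rel n `` {x}"

text \<open>The \<open>i\<close>-th coordinate modulo 1, as an element of \<open>[0, 1)\<close>, of a point of the torus.\<close>

definition torus_coord :: "(nat \<Rightarrow> real) set \<Rightarrow> nat \<Rightarrow> real" where
  "torus_coord p i = the_elem ((\<lambda>x. frac (x i)) ` p)"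

lemma equiv_torus_rel: "equiv (real_space n) (torus_rel n)"
proof (rule equivI)
  show "torus_rel n \<subseteq> real_space n \<times> real_space n" by (auto simp: torus_rel_def)
  show "refl_on (real_space n) (torus_rel n)" by (auto simp: refl_on_def torus_rel_def)
  show "sym (torus_rel n)"
  proof (rule symI)
    fix x y assume xy: "(x, y) \<in> torus_rel n"
    have "y i - x i \<in> \<int>" if "i \<in> {1..n}" for i
    proof -
      have "- (x i - y i) \<in> \<int>"
        using xy that unfolding torus_rel_def by (intro Ints_minus) auto
      then show ?thesis by simp
    qed
    then show "(y, x) \<in> torus_rel n" using xy by (auto simp: torus_rel_def)
  qed
  show "trans (torus_rel n)"
  proof (rule transI)
    fix x y z assume xyz: "(x, y) \<in> torus_rel n" "(y, z) \<in> torus_rel n"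
    have "x i - z i \<in> \<int>" if "i \<in> {1..n}" for i
    proof -
      have "(x i - y i) + (y i - z i) \<in> \<int>"
        using xyz that unfolding torus_rel_def by (intro Ints_add) auto
      then show ?thesis by simp
    qed
    then show "(x, z) \<in> torus_rel n" using xyz by (auto simp: torus_rel_def)
  qed
qed

lemma torus_coord_proj:
  assumes "x \<in> real_space n" "i \<in> {1..n}"
  shows "torus_coord (torus_proj n x) i = frac (x i)"
proof -
  have "frac (y i) = frac (x i)" if y: "y \<in> torus_proj n x" for y
  proof -
    have "x i - y i \<in> \<int>" using y assms(2) by (auto simp: torus_proj_def torus_rel_def)
    then obtain m where "x i - y i = of_int m" by (rule Ints_cases)
    then have m: "x i = y i + of_int m" by simp
    show ?thesis unfolding m by (simp add: frac_def)
  qed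
  moreover have "x \<in> torus_proj n x"
    using assms(1) equiv_class_self[OF equiv_torus_rel] by (simp add: torus_proj_def)
  ultimately have "(\<lambda>y. frac (y i)) ` torus_proj n x = {frac (x i)}" by blast
  then show ?thesis by (simp add: torus_coord_def)
qed

definition toric_arrangement :: "nat \<Rightarrow> nat set set \<Rightarrow> (nat \<Rightarrow> real) set set" where
  "toric_arrangement n G = torus_proj n ` {x \<in> real_space n. \<exists>i j. {i, j} \<in> G \<and> x i = x j}"

definition point_orientation :: "nat set set \<Rightarrow> (nat \<Rightarrow> real) set \<Rightarrow> (nat \<times> nat) set" where
  "point_orientation G p = {(i, j). {i, j} \<in> G \<and> torus_coord p i < torus_coord p j}"

definition toric_chamber :: "nat \<Rightarrow> (nat \<times> nat) set set \<Rightarrow> (nat \<Rightarrow> real) set set" where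
  "toric_chamber n P =
     {p \<in> torus n - toric_arrangement n (underlying_graph P).
        point_orientation (underlying_graph P) p \<in> P}"


section \<open>Toric total orders and toric total extensions\<close>

definition cyclic_rel :: "nat \<Rightarrow> (nat list \<times> nat list) set" where
  "cyclic_rel n = {(v, w). v \<in> permutations_of_set {1..n} \<and> w \<in> permutations_of_set {1..n} \<and>
     (\<exists>k. w = rotate k v)}"

definition toric_total_orders :: "nat \<Rightarrow> nat list set set" where
  "toric_total_orders n = permutations_of_set {1..n} // cyclic_rel n"

definition toric_order_chamber :: "nat \<Rightarrow> nat list set \<Rightarrow> (nat \<Rightarrow> real) set set" where
  "toric_order_chamber n W =
     {p \<in> torus n. inj_on (torus_coord p) {1..n} \<and> sort_key (torus_coord p) [1..<n+1] \<in> W}"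

definition toric_total_extensions :: "nat \<Rightarrow> (nat \<times> nat) set set \<Rightarrow> nat list set set" where
  "toric_total_extensions n P =
     {W \<in> toric_total_orders n. toric_order_chamber n W \<subseteq> toric_chamber n P}"

lemma rotate_inverse: "\<exists>l. rotate l (rotate k v) = v"
proof (cases "v = []")
  case False
  let ?m = "length v"
  have "rotate (?m - k mod ?m) (rotate k v) = rotate (?m - k mod ?m) (rotate (k mod ?m) v)"
    by (subst rotate_conv_mod) (rule refl)
  also have "\<dots> = rotate ?m v" using False by (simp add: rotate_rotate less_imp_le)
  also have "\<dots> = v" by simp
  finally show ?thesis by blast
qed auto

lemma equiv_cyclic_rel: "equiv (permutations_of_set {1..n}) (cyclic_rel n)"
proof (rule equivI)
  show "cyclic_rel n \<subseteq> permutations_of_set {1..n} \<times> permutations_of_set {1..n}"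
    by (auto simp: cyclic_rel_def)
  show "refl_on (permutations_of_set {1..n}) (cyclic_rel n)"
    by (auto simp: refl_on_def cyclic_rel_def intro!: exI[of _ 0])
  show "sym (cyclic_rel n)"
  proof (rule symI)
    fix v w assume vw: "(v, w) \<in> cyclic_rel n"
    then obtain k where k: "w = rotate k v" by (auto simp: cyclic_rel_def)
    obtain l where "rotate l (rotate k v) = v" using rotate_inverse by blast
    then have "\<exists>l. v = rotate l w" unfolding k by metis
    then show "(w, v) \<in> cyclic_rel n" using vw by (simp add: cyclic_rel_def)
  qed
  show "trans (cyclic_rel n)"
  proof (rule transI)
    fix u v w assume uvw: "(u, v) \<in> cyclic_rel n" "(v, w) \<in> cyclic_rel n"
    then obtain k l where "v = rotate k u" "w = rotate l v" by (auto simp: cyclic_rel_def)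
    then have "w = rotate (l + k) u" by (simp add: rotate_rotate)
    then show "(u, w) \<in> cyclic_rel n" using uvw by (simp add: cyclic_rel_def) blast
  qed
qed

lemma finite_toric_total_extensions: "finite (toric_total_extensions n P)"
proof -
  have "finite (permutations_of_set {1..n} // cyclic_rel n)"
    by (rule finite_quotient) (auto simp: cyclic_rel_def)
  then show ?thesis by (simp add: toric_total_extensions_def toric_total_orders_def)
qed


section \<open>The rational functions \<open>\<Psi>\<^sub>t\<^sub>o\<^sub>r\<close>\<close>

text \<open>Polynomials are finitely supported maps from exponent vectors to coefficients; rational
  functions are elements of the fraction field. The field below has indeterminates \<open>x\<^sub>i\<close> for
  all \<open>i :: nat\<close>, and hence contains the rational functions in \<open>x\<^sub>1, \<dots>, x\<^sub>n\<close>.\<close>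

type_synonym 'k rat_fun = "((nat \<Rightarrow>\<^sub>0 nat) \<Rightarrow>\<^sub>0 'k) fract"

definition indet :: "nat \<Rightarrow> 'k::field rat_fun" where
  "indet i = Fraction_Field.Fract (Poly_Mapping.single (Poly_Mapping.single i 1) 1) 1"

definition Psi_list :: "nat list \<Rightarrow> 'k::field rat_fun" where
  "Psi_list w = 1 / (\<Prod>i<length w. indet (w ! i) - indet (w ! (Suc i mod length w)))"

text \<open>\<^term>\<open>Psi_list\<close> is invariant under rotation, see \<open>Psi_toric_order_eq\<close>.\<close>

definition Psi_toric_order :: "nat list set \<Rightarrow> 'k::field rat_fun" where
  "Psi_toric_order W = the_elem (Psi_list ` W)"

definition Psi_tor :: "nat \<Rightarrow> (nat \<times> nat) set set \<Rightarrow> 'k::field rat_fun" where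
  "Psi_tor n P = (\<Sum>W\<in>toric_total_extensions n P. Psi_toric_order W)"

lemma Psi_list_rotate1: "Psi_list (rotate1 w) = Psi_list w"
proof (cases "w = []")
  case False
  define m where "m = length w"
  define f where "f i = (indet (w ! i) - indet (w ! (Suc i mod m)) :: 'a rat_fun)" for i
  have m: "m > 0" using False by (simp add: m_def)
  have "(\<Prod>i<m. indet (rotate1 w ! i) - indet (rotate1 w ! (Suc i mod m))) = (\<Prod>i<m. f (Suc i mod m))"
  proof (rule prod.cong[OF refl])
    fix i assume "i \<in> {..<m}"
    then show "indet (rotate1 w ! i) - indet (rotate1 w ! (Suc i mod m)) = f (Suc i mod m)"
      using m by (simp add: f_def nth_rotate1 m_def)
  qed
  also have "\<dots> = (\<Prod>i<m. f i)"
  proof -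
    obtain k where k: "m = Suc k" using m by (cases m) auto
    have "(\<Prod>i<m. f (Suc i mod m)) = (\<Prod>i<k. f (Suc i)) * f 0"
      unfolding k by (simp add: mult.commute)
    also have "\<dots> = (\<Prod>i<m. f i)"
      unfolding k by (subst prod.lessThan_Suc_shift) (simp add: mult.commute)
    finally show ?thesis .
  qed
  finally show ?thesis by (simp add: Psi_list_def f_def m_def)
qed simp

lemma Psi_list_rotate: "Psi_list (rotate k w) = Psi_list w"
  by (induction k) (simp_all add: Psi_list_rotate1)

lemma Psi_toric_order_eq:
  assumes "W \<in> toric_total_orders n" "w \<in> W"
  shows "Psi_toric_order W = Psi_list w"
proof -
  have "Psi_list v = (Psi_list w :: 'a rat_fun)" if "v \<in> W" for v
  proof -
    have "(w, v) \<in> cyclic_rel n"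
      using quotient_eq_iff[OF equiv_cyclic_rel _ _ assms(2) that] assms(1)
      unfolding toric_total_orders_def by blast
    then show ?thesis by (auto simp: cyclic_rel_def Psi_list_rotate)
  qed
  then have "(Psi_list :: _ \<Rightarrow> 'a rat_fun) ` W = {Psi_list w}" using assms(2) by blast
  then show ?thesis by (simp add: Psi_toric_order_def)
qed

end

theory Submission
  imports Defs
begin

(* Suppose V - {v} splits into nonempty parts A and B with no edge between them. Every toric total
   order has a unique representative v # u, and whether it extends P depends only on the orientation
   of G induced by v # u, hence only on the restrictions a and b of u to A and B. So the toric total
   extensions fall into full shuffle sets of pairs (a, b), and over each of them the cyclic products
   based at v sum to zero. A cut vertex gives such a v. If G is
   disconnected with at least three vertices, split V along a component; any vertex v of a side with
   at least two vertices will do. *)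

section \<open>The shuffle identity\<close>

text \<open>This is the reciprocal product of successive differences along a path. Start
  \<open>c\<close> and end \<open>z\<close> are separate so that an induction can move the start
  while the end stays fixed; \<open>c = z\<close> closes the path to a cycle.\<close>

primrec chain :: "('a \<Rightarrow> 'f::field) \<Rightarrow> 'a \<Rightarrow> 'a \<Rightarrow> 'a list \<Rightarrow> 'f" where
  "chain f z c [] = 1 / (f c - f z)"
| "chain f z c (a # as) = chain f z a as / (f c - f a)"

text \<open>A shuffle begins with the head of \<open>a\<close> or of \<open>b\<close>. Each choice
  moves the start to that head, and partial fractions recombine the two partial sums. The
  application is \<open>c = z\<close>, where the factor \<open>f c - f z\<close> vanishes; general
  \<open>c\<close> is what the induction needs. The last hypothesis rules out \<open>c = z\<close>
  with an empty list, where \<open>f c - f z\<close> could not be cancelled.\<close>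

lemma sum_chain_shuffles:
  assumes "inj f" "distinct a" "distinct b" "set a \<inter> set b = {}"
    and "z \<notin> set a \<union> set b" "c \<notin> set a \<union> set b" "c \<noteq> z \<or> a \<noteq> [] \<and> b \<noteq> []"
  shows "(\<Sum>u\<in>shuffles a b. chain f z c u) = (f c - f z) * chain f z c a * chain f z c b"
  using assms(2-)
proof (induction a b arbitrary: c rule: shuffles.induct)
  case (1 ys)
  then have "f c - f z \<noteq> 0" using \<open>inj f\<close> by (auto simp: inj_eq)
  then show ?case by simp
next
  case (2 xs)
  then have "f c - f z \<noteq> 0" using \<open>inj f\<close> by (auto simp: inj_eq)
  then show ?case by simp
next
  case (3 x xs y ys)
  define p where "p = chain f z x xs"
  define q where "q = chain f z y ys"
  have ne: "f x - f y \<noteq> 0" "f y - f x \<noteq> 0" "f c - f x \<noteq> 0" "f c - f y \<noteq> 0"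
    using 3 \<open>inj f\<close> by (auto simp: inj_eq)
  \<comment> \<open>The new start \<open>x\<close> differs from \<open>z\<close>, so the induction
    hypothesis applies even if \<open>xs\<close> is empty and \<open>c = z\<close>.\<close>
  have IH1: "(\<Sum>u\<in>shuffles xs (y # ys). chain f z x u) = (f x - f z) * p * (q / (f x - f y))"
    using 3 by (subst "3.IH"(1)) (auto simp: p_def q_def)
  have IH2: "(\<Sum>u\<in>shuffles (x # xs) ys. chain f z y u) = (f y - f z) * (p / (f y - f x)) * q"
    using 3 by (subst "3.IH"(2)) (auto simp: p_def q_def)
  have "(\<Sum>u\<in>shuffles (x # xs) (y # ys). chain f z c u) =
      (\<Sum>u\<in>(#) x ` shuffles xs (y # ys). chain f z c u) +
      (\<Sum>u\<in>(#) y ` shuffles (x # xs) ys. chain f z c u)"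
    unfolding shuffles.simps using 3 by (intro sum.union_disjoint) auto
  also have "\<dots> = (f x - f z) * p * (q / (f x - f y)) / (f c - f x) +
      (f y - f z) * (p / (f y - f x)) * q / (f c - f y)"
    by (simp add: sum.reindex sum_divide_distrib[symmetric] IH1 IH2)
  also have "\<dots> = (f c - f z) * (p / (f c - f x)) * (q / (f c - f y))"
  proof -
    have "(f x - f z) * p * (q / (f x - f y)) / (f c - f x) +
      (f y - f z) * (p / (f y - f x)) * q / (f c - f y) =
      p * q / (f x - f y) * ((f x - f z) / (f c - f x) - (f y - f z) / (f c - f y))"
      using ne by (simp add: divide_simps) (simp add: algebra_simps)
    \<comment> \<open>Over the common denominator the numerator is
      \<open>(f x - f z) * (f c - f y) - (f y - f z) * (f c - f x)\<close>, which factors.\<close>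
    also have "(f x - f z) / (f c - f x) - (f y - f z) / (f c - f y) =
      (f x - f y) * (f c - f z) / ((f c - f x) * (f c - f y))"
      using ne by (simp add: divide_simps) (simp add: algebra_simps)
    finally show ?thesis using ne by simp
  qed
  finally show ?case by (simp add: p_def q_def)
qed

text \<open>\<open>c # u\<close> and \<open>u @ [z]\<close> list the same path shifted by one, so
  equal indices pair each vertex with its successor. This links the indexed product in
  \<open>Psi_list\<close> to the recursion of \<open>chain\<close>.\<close>

lemma prod_chain:
  "1 / (\<Prod>i<Suc (length u). f ((c # u) ! i) - f ((u @ [z]) ! i)) = chain f z c u"
proof (induction u arbitrary: c)
  case (Cons a u)
  have *: "(\<Prod>i<Suc (length (a # u)). f ((c # a # u) ! i) - f (((a # u) @ [z]) ! i)) =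
      (f c - f a) * (\<Prod>i<Suc (length u). f ((a # u) ! i) - f ((u @ [z]) ! i))"
    by (subst prod.lessThan_Suc_shift) simp
  show ?case unfolding chain.simps Cons[of a, symmetric] * by simp
qed simp

lemma Psi_list_Cons: "Psi_list (v # u) = chain indet v v u"
proof -
  have "(v # u) ! (Suc i mod length (v # u)) = (u @ [v]) ! i" if "i < Suc (length u)" for i
  \<comment> \<open>The modulus takes effect only at the last index, where both sides are
    \<open>v\<close>.\<close>
  proof (cases "i = length u")
    case False
    then have "i < length u" using that by simp
    then show ?thesis by (simp add: nth_append)
  qed simp
  then show ?thesis by (simp add: Psi_list_def prod_chain[symmetric])
qed

text \<open>This is the only property of the indeterminates that the shuffle identity needs: it
  keeps the denominators nonzero. Supports are compared twice, first to recover the monomial and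
  then its variable.\<close>

lemma inj_indet: "inj (indet :: nat \<Rightarrow> 'k::field rat_fun)"
proof (rule injI)
  fix i j assume "indet i = (indet j :: 'k rat_fun)"
  then have "Poly_Mapping.single (Poly_Mapping.single i (1::nat)) (1::'k) =
      Poly_Mapping.single (Poly_Mapping.single j 1) 1"
    by (simp add: indet_def eq_fract)
  then have "Poly_Mapping.single i (1::nat) = Poly_Mapping.single j 1"
    by (metis keys_single singleton_inject zero_neq_one)
  then show "i = j" by (metis keys_single singleton_inject zero_neq_one)
qed

section \<open>Orientations induced by lists\<close>

primrec before :: "'a list \<Rightarrow> ('a \<times> 'a) set" where
  "before [] = {}"
| "before (x # xs) = {x} \<times> set xs \<union> before xs"

lemma before_subset: "before w \<subseteq> set w \<times> set w"
  by (induction w) auto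

lemma before_append: "before (xs @ ys) = before xs \<union> before ys \<union> set xs \<times> set ys"
  by (induction xs) auto

lemma before_filter: "before (filter R w) = {(i, j) \<in> before w. R i \<and> R j}"
  by (induction w) auto

lemma before_total: "i \<in> set w \<Longrightarrow> j \<in> set w \<Longrightarrow> i \<noteq> j \<Longrightarrow> (i, j) \<in> before w \<or> (j, i) \<in> before w"
  by (induction w) auto

lemma sorted_wrt_iff_before: "sorted_wrt R w \<longleftrightarrow> (\<forall>(i, j)\<in>before w. R i j)"
  by (induction w) auto

text \<open>The list counterpart of \<open>point_orientation\<close>.\<close>

definition orient :: "nat set set \<Rightarrow> nat list \<Rightarrow> (nat \<times> nat) set" where
  "orient G w = {(i, j) \<in> before w. {i, j} \<in> G}"

text \<open>The head of a list is a source. Moving it to the end makes it a sink and leaves the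
  order of all other vertices alone, which is exactly a flip.\<close>

lemma orient_rotate1:
  assumes "distinct (x # xs)" "\<And>i. {i} \<notin> G"
  shows "orient G (xs @ [x]) = flip x (orient G (x # xs))"
proof -
  have "(i, j) \<notin> before xs" if "x \<in> {i, j}" for i j
    using that assms(1) before_subset[of xs] by auto
  then show ?thesis
    using assms by (auto simp: orient_def before_append flip_def insert_commute)
qed

text \<open>Every edge among the entries of \<open>u\<close> lies inside \<open>A\<close> or inside
  \<open>B\<close>, so its direction can be read off one of the two restrictions. Edges at the head
  \<open>v\<close> to these entries leave \<open>v\<close> in either list.\<close>

lemma orient_eq_if_filter_eq:
  assumes "set u \<subseteq> A \<union> B" "set u' = set u" "\<And>i j. i \<in> A \<Longrightarrow> j \<in> B \<Longrightarrow> {i, j} \<notin> G"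
    and "filter (\<lambda>i. i \<in> A) u' = filter (\<lambda>i. i \<in> A) u"
    and "filter (\<lambda>i. i \<in> B) u' = filter (\<lambda>i. i \<in> B) u"
  shows "orient G (v # u') = orient G (v # u)"
proof -
  have *: "orient G w = {(i, j) \<in> before (filter (\<lambda>i. i \<in> A) w) \<union> before (filter (\<lambda>i. i \<in> B) w).
      {i, j} \<in> G}" if "set w \<subseteq> A \<union> B" for w
  proof -
    have "i \<in> A \<and> j \<in> A \<or> i \<in> B \<and> j \<in> B" if "(i, j) \<in> before w" "{i, j} \<in> G" for i j
    proof -
      have "i \<in> A \<union> B" "j \<in> A \<union> B" using that \<open>set w \<subseteq> A \<union> B\<close> before_subset[of w] by blast+
      then show ?thesis using assms(3)[of i j] assms(3)[of j i] that(2)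
        by (auto simp: insert_commute)
    qed
    then show ?thesis by (auto simp: orient_def before_filter)
  qed
  have "orient G u' = orient G u" using assms by (simp add: *)
  then show ?thesis using assms(2) by (auto simp: orient_def)
qed

text \<open>Sorting yields weak inequalities along the list. Distinct coordinates make them strict,
  and totality of \<open>before\<close> gives the converse.\<close>

lemma point_orientation_sort_key:
  assumes "inj_on (torus_coord p) {1..n}" "\<And>i j. {i, j} \<in> G \<Longrightarrow> i \<in> {1..n} \<and> j \<in> {1..n} \<and> i \<noteq> j"
  shows "point_orientation G p = orient G (sort_key (torus_coord p) [1..<n+1])"
proof -
  define w where "w = sort_key (torus_coord p) [1..<n+1]"
  have set: "set w = {1..n}" by (auto simp: w_def)
  have dist: "distinct w" by (simp add: w_def)
  have "sorted (map (torus_coord p) w)" by (simp add: w_def)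
  then have le: "torus_coord p i \<le> torus_coord p j" if "(i, j) \<in> before w" for i j
    using that unfolding sorted_wrt_map unfolding sorted_wrt_iff_before by auto
  have "torus_coord p i < torus_coord p j \<longleftrightarrow> (i, j) \<in> before w" if "{i, j} \<in> G" for i j
  proof -
    have ij: "i \<in> {1..n}" "j \<in> {1..n}" "i \<noteq> j" using assms(2)[OF that] by auto
    then have "torus_coord p i \<noteq> torus_coord p j" using inj_onD[OF assms(1)] by blast
    moreover have "(i, j) \<in> before w \<or> (j, i) \<in> before w"
      by (rule before_total) (simp_all only: set ij not_False_eq_True)
    ultimately show ?thesis using le by (metis order.order_iff_strict leD)
  qed
  then show ?thesis by (auto simp: point_orientation_def orient_def w_def)
qed

section \<open>Toric posets and toric total extensions\<close>

lemma toric_poset_quiver: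
  assumes "P \<in> toric_posets n" "Q \<in> P"
  shows "Q \<in> quivers n"
  using assms equiv_flip_equiv[of n] in_quotient_imp_subset unfolding toric_posets_def by blast

lemma toric_poset_flip:
  assumes "P \<in> toric_posets n" "Q \<in> P" "k \<in> {1..n}" "is_source Q k \<or> is_sink Q k"
  shows "flip k Q \<in> P"
proof -
  have Q: "Q \<in> quivers n" by (rule toric_poset_quiver[OF assms(1,2)])
  then have "(Q, flip k Q) \<in> flip_step n" using assms by (auto simp: flip_step_def)
  then have "(Q, flip k Q) \<in> flip_equiv n"
    using Q flip_quivers[OF Q assms(4)] by (auto simp: flip_equiv_def)
  then show ?thesis
    using assms(1,2) in_quotient_imp_closed[OF equiv_flip_equiv] unfolding toric_posets_def by blast
qed

lemma underlying_graph_edge: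
  assumes "P \<in> toric_posets n" "{i, j} \<in> underlying_graph P"
  shows "i \<in> {1..n} \<and> j \<in> {1..n} \<and> i \<noteq> j"
proof -
  obtain Q where Q: "Q \<in> P"
    using assms(1) in_quotient_imp_non_empty[OF equiv_flip_equiv] unfolding toric_posets_def by blast
  then have "{i, j} \<in> quiver_graph Q" using assms underlying_graph_eq by metis
  then show ?thesis using toric_poset_quiver[OF assms(1) Q]
    by (auto simp: quiver_graph_def quivers_def irrefl_def doubleton_eq_iff)
qed

text \<open>Each single rotation flips the orientation at the head of the list, a source, so it
  never leaves the flip class.\<close>

lemma orient_rotate_in_toric_poset:
  assumes "P \<in> toric_posets n" "w \<in> permutations_of_set {1..n}"
    and "orient (underlying_graph P) w \<in> P"
  shows "orient (underlying_graph P) (rotate k w) \<in> P"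
proof (induction k)
  case (Suc k)
  have "distinct (rotate k w)" "set (rotate k w) = {1..n}"
    using assms(2) by (auto simp: permutations_of_set_def)
  then show ?case using Suc
  proof (cases "rotate k w")
    case (Cons x xs)
    have sing: "{i} \<notin> underlying_graph P" for i
      using underlying_graph_edge[OF assms(1), of i i] by auto
    have d: "distinct (x # xs)" and x: "x \<in> {1..n}"
      using Cons \<open>distinct (rotate k w)\<close> \<open>set (rotate k w) = {1..n}\<close> by auto
    have "is_source (orient (underlying_graph P) (x # xs)) x"
      using d before_subset[of xs] by (auto simp: is_source_def orient_def)
    then have "flip x (orient (underlying_graph P) (x # xs)) \<in> P"
      using toric_poset_flip[OF assms(1) _ x] Suc Cons by simp
    then show ?thesis using orient_rotate1[OF d sing] Cons by simp
  qed simp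
qed (use assms in simp)

section \<open>Toric total extensions decided by a single list\<close>

lemma ex_torus_point_of_order:
  assumes "w \<in> permutations_of_set {1..n}"
  obtains p where "p \<in> torus n" "inj_on (torus_coord p) {1..n}"
    "sort_key (torus_coord p) [1..<n+1] = w"
proof -
  have w: "distinct w" "set w = {1..n}" "length w = n"
    using assms by (auto simp: permutations_of_set_def length_finite_permutations_of_set)
  define pos where "pos = the_inv_into {..<n} ((!) w)"
  have inj: "inj_on ((!) w) {..<n}" using w by (auto simp: inj_on_nth)
  have pos: "pos (w ! k) = k" if "k < n" for k
    using inj that by (simp add: pos_def the_inv_into_f_f)
  \<comment> \<open>The entry at position \<open>k\<close> gets the coordinate \<open>k / n\<close>.
    These values lie in [0,1), so \<open>frac\<close> fixes them, and they increase along
    \<open>w\<close>.\<close>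
  define x where "x = restrict (\<lambda>i. real (pos i) / real n) {1..n}"
  have xs: "x \<in> real_space n" by (simp add: x_def real_space_def)
  define p where "p = torus_proj n x"
  have coord: "torus_coord p (w ! k) = real k / real n" if "k < n" for k
  proof -
    have mem: "w ! k \<in> {1..n}" using that w nth_mem by metis
    then have "torus_coord p (w ! k) = frac (x (w ! k))"
      unfolding p_def by (rule torus_coord_proj[OF xs])
    also have "x (w ! k) = real k / real n" using mem that by (simp add: x_def pos)
    also have "frac (real k / real n) = real k / real n" using that by (simp add: frac_eq)
    finally show ?thesis .
  qed
  have map: "map (torus_coord p) w = map (\<lambda>k. real k / real n) [0..<n]"
    using w(3) coord by (intro nth_equalityI) auto
  have "sorted (map (torus_coord p) w)"
    unfolding map sorted_wrt_map by (rule sorted_wrt_mono_rel[OF _ sorted_upt]) (simp add: divide_right_mono)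
  moreover have inj_p: "inj_on (torus_coord p) {1..n}"
  proof -
    have "distinct (map (torus_coord p) w)"
      unfolding map by (auto simp: distinct_map inj_on_def)
    then show ?thesis using w by (simp add: distinct_map)
  qed
  moreover have set_upt: "set [1..<n+1] = {1..n}" by auto
  moreover have "mset [1..<n+1] = mset w"
    using set_eq_iff_mset_eq_distinct[of "[1..<n+1]" w] w set_upt by (simp del: upt_Suc)
  ultimately have "sort_key (torus_coord p) [1..<n+1] = w"
    by (intro sort_key_inj_key_eq) simp_all
  moreover have "p \<in> torus n" using xs by (auto simp: p_def torus_def torus_proj_def quotientI)
  ultimately show thesis using that inj_p by blast
qed

lemma not_in_toric_arrangement:
  assumes "p \<in> torus n" "inj_on (torus_coord p) {1..n}"
    and "\<And>i j. {i, j} \<in> G \<Longrightarrow> i \<in> {1..n} \<and> j \<in> {1..n} \<and> i \<noteq> j"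
  shows "p \<notin> toric_arrangement n G"
proof
  assume "p \<in> toric_arrangement n G"
  then obtain x i j where *: "p = torus_proj n x" "x \<in> real_space n" "{i, j} \<in> G" "x i = x j"
    unfolding toric_arrangement_def by blast
  then have "torus_coord p i = torus_coord p j" using assms(3)[OF *(3)] by (simp add: torus_coord_proj)
  then show False using assms(2) assms(3)[OF *(3)] by (auto dest: inj_onD)
qed

text \<open>Left to right, the chamber of the order contains a point whose sorted list is exactly
  \<open>w\<close>. Right to left, every point of that chamber sorts to a rotation of
  \<open>w\<close>, whose orientation stays in \<open>P\<close>.\<close>

lemma toric_total_extension_iff:
  assumes P: "P \<in> toric_posets n" and w: "w \<in> permutations_of_set {1..n}"
  shows "cyclic_rel n `` {w} \<in> toric_total_extensions n P \<longleftrightarrow> orient (underlying_graph P) w \<in> P"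
proof
  let ?G = "underlying_graph P"
  note edge = underlying_graph_edge[OF P]
  have self: "w \<in> cyclic_rel n `` {w}" using equiv_class_self[OF equiv_cyclic_rel w] .
  {
    assume "cyclic_rel n `` {w} \<in> toric_total_extensions n P"
    then have sub: "toric_order_chamber n (cyclic_rel n `` {w}) \<subseteq> toric_chamber n P"
      by (simp add: toric_total_extensions_def)
    obtain p where p: "p \<in> torus n" "inj_on (torus_coord p) {1..n}"
      "sort_key (torus_coord p) [1..<n+1] = w" using ex_torus_point_of_order[OF w] .
    then have "p \<in> toric_chamber n P" using sub self by (auto simp: toric_order_chamber_def)
    then show "orient ?G w \<in> P"
      using point_orientation_sort_key[OF p(2) edge] p(3) by (simp add: toric_chamber_def)
  }
  assume o: "orient ?G w \<in> P"
  have "p \<in> toric_chamber n P" if "p \<in> toric_order_chamber n (cyclic_rel n `` {w})" for p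
  proof -
    have p: "p \<in> torus n" "inj_on (torus_coord p) {1..n}"
      "(w, sort_key (torus_coord p) [1..<n+1]) \<in> cyclic_rel n"
      using that by (auto simp: toric_order_chamber_def)
    then obtain k where "sort_key (torus_coord p) [1..<n+1] = rotate k w"
      by (auto simp: cyclic_rel_def)
    then have "point_orientation ?G p \<in> P"
      using point_orientation_sort_key[OF p(2) edge] orient_rotate_in_toric_poset[OF P w o] by simp
    then show ?thesis
      using p not_in_toric_arrangement[OF p(1,2) edge] by (simp add: toric_chamber_def)
  qed
  then show "cyclic_rel n `` {w} \<in> toric_total_extensions n P"
    using w by (auto simp: toric_total_extensions_def toric_total_orders_def quotientI)
qed

section \<open>Unique representatives with a prescribed head\<close>

lemma toric_total_order_representative:
  assumes "W \<in> toric_total_orders n" "v \<in> {1..n}"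
  obtains u where "v # u \<in> permutations_of_set {1..n}" "W = cyclic_rel n `` {v # u}"
proof -
  obtain w where w: "w \<in> permutations_of_set {1..n}" "W = cyclic_rel n `` {w}"
    using assms(1) unfolding toric_total_orders_def by (rule quotientE)
  then have "v \<in> set w" using assms(2) by (simp add: permutations_of_set_def)
  then obtain xs ys where xs: "w = xs @ v # ys" by (auto simp: in_set_conv_decomp)
  then have rot: "rotate (length xs) w = v # ys @ xs" by (simp add: rotate_append)
  have "v # ys @ xs \<in> permutations_of_set {1..n}"
    using w(1) unfolding xs by (auto simp: permutations_of_set_def)
  moreover from this have "(w, v # ys @ xs) \<in> cyclic_rel n"
    using w(1) rot by (metis (mono_tags, lifting) case_prodI cyclic_rel_def mem_Collect_eq)
  ultimately show thesis using that w(2) equiv_class_eq[OF equiv_cyclic_rel] by blast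
qed

text \<open>Entries are distinct, so the head determines the amount of rotation modulo the
  length.\<close>

lemma cyclic_rel_same_hd:
  assumes "(v # u, v # u') \<in> cyclic_rel n"
  shows "u' = u"
proof -
  obtain k where k: "v # u' = rotate k (v # u)" and d: "distinct (v # u)"
    using assms by (auto simp: cyclic_rel_def permutations_of_set_def)
  have "(v # u) ! (k mod length (v # u)) = (v # u) ! 0"
    using k hd_rotate_conv_nth[of "v # u" k] by (metis list.sel(1) list.distinct(1) nth_Cons_0)
  then have "k mod length (v # u) = 0"
    using d by (subst (asm) nth_eq_iff_index_eq) auto
  then have "v # u' = v # u" using k by (metis rotate_id)
  then show ?thesis by simp
qed

text \<open>Cutting every cyclic order open at \<open>v\<close> turns the sum over classes into a
  sum over lists.\<close>

lemma Psi_tor_eq_sum_lists: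
  assumes P: "P \<in> toric_posets n" and v: "v \<in> {1..n}"
  shows "Psi_tor n P = (\<Sum>u | v # u \<in> permutations_of_set {1..n} \<and> orient (underlying_graph P) (v # u) \<in> P.
    Psi_list (v # u))"
proof -
  let ?U = "{u. v # u \<in> permutations_of_set {1..n} \<and> orient (underlying_graph P) (v # u) \<in> P}"
  have "bij_betw (\<lambda>u. cyclic_rel n `` {v # u}) ?U (toric_total_extensions n P)"
  proof (rule bij_betw_imageI)
    show "inj_on (\<lambda>u. cyclic_rel n `` {v # u}) ?U"
    proof (rule inj_onI)
      fix u u' assume "u \<in> ?U" "u' \<in> ?U" "cyclic_rel n `` {v # u} = cyclic_rel n `` {v # u'}"
      then have "(v # u, v # u') \<in> cyclic_rel n"
        using eq_equiv_class_iff[OF equiv_cyclic_rel] by blast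
      then show "u = u'" using cyclic_rel_same_hd by metis
    qed
    show "(\<lambda>u. cyclic_rel n `` {v # u}) ` ?U = toric_total_extensions n P"
    proof
      show "(\<lambda>u. cyclic_rel n `` {v # u}) ` ?U \<subseteq> toric_total_extensions n P"
        using toric_total_extension_iff[OF P] by auto
      show "toric_total_extensions n P \<subseteq> (\<lambda>u. cyclic_rel n `` {v # u}) ` ?U"
      proof
        fix W assume W: "W \<in> toric_total_extensions n P"
        then obtain u where "v # u \<in> permutations_of_set {1..n}" "W = cyclic_rel n `` {v # u}"
          using toric_total_order_representative[OF _ v] by (auto simp: toric_total_extensions_def)
        then show "W \<in> (\<lambda>u. cyclic_rel n `` {v # u}) ` ?U"
          using W toric_total_extension_iff[OF P] by blast
      qed
    qed
  qed
  then have "Psi_tor n P = (\<Sum>u\<in>?U. Psi_toric_order (cyclic_rel n `` {v # u}))"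
    unfolding Psi_tor_def by (rule sum.reindex_bij_betw[symmetric])
  also have "\<dots> = (\<Sum>u\<in>?U. Psi_list (v # u))"
  proof (rule sum.cong[OF refl])
    fix u assume "u \<in> ?U"
    then have u: "v # u \<in> permutations_of_set {1..n}" by simp
    then show "Psi_toric_order (cyclic_rel n `` {v # u}) = Psi_list (v # u)"
      using equiv_class_self[OF equiv_cyclic_rel u]
      by (intro Psi_toric_order_eq) (auto simp: toric_total_orders_def intro: quotientI)
  qed
  finally show ?thesis .
qed

section \<open>Vanishing when the vertices other than \<open>v\<close> split\<close>

lemma Psi_tor_eq_0_if_split:
  assumes P: "P \<in> toric_posets n" and v: "v \<in> {1..n}"
    and AB: "A \<union> B = {1..n} - {v}" "A \<inter> B = {}" "A \<noteq> {}" "B \<noteq> {}"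
    and edge: "\<And>i j. i \<in> A \<Longrightarrow> j \<in> B \<Longrightarrow> {i, j} \<notin> underlying_graph P"
  shows "Psi_tor n P = (0 :: 'k::field rat_fun)"
proof -
  let ?G = "underlying_graph P"
  define U where "U = {u. v # u \<in> permutations_of_set {1..n} \<and> orient ?G (v # u) \<in> P}"
  \<comment> \<open>The sum over \<open>U\<close> is grouped by the fibres of \<open>g\<close>, each
    of which turns out to be a full shuffle set.\<close>
  define g where "g u = (filter (\<lambda>i. i \<in> A) u, filter (\<lambda>i. i \<in> B) u)" for u
  have U_set: "set u = A \<union> B \<and> distinct u" if "u \<in> U" for u
  proof -
    have "insert v (set u) = {1..n}" "v \<notin> set u" "distinct u"
      using that by (simp_all add: U_def permutations_of_set_def)
    then show ?thesis using AB(1) by blast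
  qed
  have perm: "v # u \<in> permutations_of_set {1..n}" if "set u = A \<union> B" "distinct u" for u
  proof -
    have "insert v (A \<union> B) = {1..n}" "v \<notin> A \<union> B" using AB(1) v by blast+
    then show ?thesis using that by (simp add: permutations_of_set_def)
  qed
  have "finite U"
  proof (rule finite_subset)
    show "U \<subseteq> tl ` permutations_of_set {1..n}" by (force simp: U_def)
  qed simp
  have "(\<Sum>u | u \<in> U \<and> g u = y. chain indet v v u) = (0 :: 'k rat_fun)" if y: "y \<in> g ` U" for y
  proof -
    obtain u where u: "u \<in> U" "y = g u" using y by blast
    define a b where "a = filter (\<lambda>i. i \<in> A) u" and "b = filter (\<lambda>i. i \<in> B) u"
    have ab: "set a = A" "set b = B" "distinct a" "distinct b" "g u = (a, b)"
      using U_set[OF u(1)] by (auto simp: a_def b_def g_def)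
    have "{u' \<in> U. g u' = y} = shuffles a b"
    proof (intro equalityI subsetI)
      fix u' assume "u' \<in> {u' \<in> U. g u' = y}"
      then have u': "u' \<in> U" "a = filter (\<lambda>i. i \<in> A) u'" "b = filter (\<lambda>i. i \<in> B) u'"
        using u(2) ab(5) by (auto simp: g_def)
      \<comment> \<open>On entries from \<open>A \<union> B\<close>, membership in \<open>B\<close>
        is the complement of membership in \<open>A\<close>, the form required by
        \<open>partition_in_shuffles\<close>.\<close>
      have "filter (\<lambda>i. i \<in> B) u' = filter (\<lambda>i. i \<notin> A) u'"
        using U_set[OF u'(1)] AB(2) by (intro filter_cong) auto
      then show "u' \<in> shuffles a b"
        using partition_in_shuffles[of u' "\<lambda>i. i \<in> A"] u' by simp
    next
      fix u' assume u': "u' \<in> shuffles a b"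
      have set: "set u' = A \<union> B" using set_shuffles[OF u'] ab by simp
      have dist: "distinct u'" using distinct_disjoint_shuffles[OF _ _ _ u'] ab AB(2) by simp
      have fA: "filter (\<lambda>i. i \<in> A) u' = a"
        using filter_shuffles_disjoint1(1)[OF _ u'] ab AB(2) by simp
      have fB: "filter (\<lambda>i. i \<in> B) u' = b"
        using filter_shuffles_disjoint2(1)[OF _ u'] ab AB(2) by simp
      \<comment> \<open>Equal restrictions give equal orientations, so every shuffle inherits
        membership in \<open>U\<close> from \<open>u\<close>.\<close>
      have "orient ?G (v # u') = orient ?G (v # u)"
        by (rule orient_eq_if_filter_eq[where A = A and B = B, OF _ _ edge])
          (use set U_set[OF u(1)] fA fB in \<open>simp_all add: a_def b_def\<close>)
      then show "u' \<in> {u' \<in> U. g u' = y}"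
        using u perm[OF set dist] fA fB ab(5) by (simp add: U_def g_def)
    qed
    moreover have "v \<notin> A \<union> B" using AB(1) by blast
    \<comment> \<open>With start and end both \<open>v\<close> the prefactor is zero;
      \<open>a\<close> and \<open>b\<close> are nonempty because \<open>A\<close> and
      \<open>B\<close> are.\<close>
    ultimately show ?thesis
      using sum_chain_shuffles[OF inj_indet, of a b v v] ab AB by auto
  qed
  then have "(\<Sum>u\<in>U. chain indet v v u) = (0 :: 'k rat_fun)"
    by (subst sum.image_gen[OF \<open>finite U\<close>, of _ g]) simp
  then show ?thesis
    unfolding Psi_tor_eq_sum_lists[OF P v] U_def[symmetric] by (simp only: Psi_list_Cons)
qed

section \<open>Splitting disconnected graphs\<close>

text \<open>One side is the component of a vertex \<open>x\<close> that does not reach some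
  \<open>y\<close>; an edge leaving it would extend reachability from \<open>x\<close>.\<close>

lemma not_connected_split:
  assumes "\<not> graph_connected V E"
  obtains A B where "A \<union> B = V" "A \<inter> B = {}" "A \<noteq> {}" "B \<noteq> {}"
    "\<And>i j. i \<in> A \<Longrightarrow> j \<in> B \<Longrightarrow> {i, j} \<notin> E"
proof -
  obtain x y where xy: "x \<in> V" "y \<in> V" "(x, y) \<notin> graph_reach V E"
    using assms by (auto simp: graph_connected_def)
  define A where "A = graph_reach V E `` {x}"
  have A: "A \<subseteq> V" by (auto simp: A_def graph_reach_def)
  have "{i, j} \<notin> E" if "i \<in> A" "j \<in> V - A" for i j
  proof
    assume "{i, j} \<in> E"
    then have "(i, j) \<in> {(a, b). a \<in> V \<and> b \<in> V \<and> {a, b} \<in> E}" using that A by auto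
    then have "(x, j) \<in> graph_reach V E"
      using that unfolding A_def graph_reach_def by (auto intro: rtrancl_into_rtrancl)
    then show False using that by (simp add: A_def)
  qed
  moreover have "x \<in> A" using xy by (simp add: A_def graph_reach_def)
  moreover have "y \<in> V - A" using xy by (simp add: A_def)
  ultimately show thesis using that[of A "V - A"] A by blast
qed

text \<open>A connected remainder has at most one component (none if it is empty), while the
  original graph has at least one, namely that of \<open>v\<close>. So the count could not
  increase.\<close>

lemma cut_vertex_not_connected:
  assumes "finite V" "cut_vertex V E v"
  shows "\<not> graph_connected (V - {v}) E"
proof
  assume conn: "graph_connected (V - {v}) E"
  have "v \<in> V" using assms(2) by (simp add: cut_vertex_def)
  then have "graph_components V E \<noteq> {}" by (auto simp: graph_components_def quotient_def)
  moreover have "finite (graph_components V E)"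
    unfolding graph_components_def
    by (rule finite_quotient[OF assms(1)]) (auto simp: graph_reach_def)
  ultimately have "card (graph_components V E) \<ge> 1" by (simp add: Suc_leI card_gt_0_iff)
  moreover have "graph_components (V - {v}) E \<subseteq> {V - {v}}"
    using conn by (auto simp: graph_components_def quotient_def graph_connected_def graph_reach_def)
  then have "card (graph_components (V - {v}) E) \<le> 1"
    using card_mono[of "{V - {v}}"] by fastforce
  ultimately show False using assms(2) by (simp add: cut_vertex_def)
qed

theorem theorem1p5:
  fixes n :: nat and P :: "(nat \<times> nat) set set" and G :: "nat set set"
  assumes "P \<in> toric_posets n"
    and "G = underlying_graph P"
    and "(\<not> graph_connected {1..n} G \<and> n \<ge> 3) \<or> (\<exists>v. cut_vertex {1..n} G v)"
  shows "Psi_tor n P = (0 :: 'k::field rat_fun)"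
  using assms(3)
proof
  assume *: "\<not> graph_connected {1..n} G \<and> n \<ge> 3"
  then obtain A B where AB: "A \<union> B = {1..n}" "A \<inter> B = {}" "A \<noteq> {}" "B \<noteq> {}"
    "\<And>i j. i \<in> A \<Longrightarrow> j \<in> B \<Longrightarrow> {i, j} \<notin> G"
    using not_connected_split by metis
  \<comment> \<open>The base vertex is taken from a side with at least two vertices, so that this
    side stays nonempty after its removal.\<close>
  have wlog: "Psi_tor n P = (0 :: 'k rat_fun)"
    if AB: "A \<union> B = {1..n}" "A \<inter> B = {}" "B \<noteq> {}" "card A \<ge> 2"
      "\<And>i j. i \<in> A \<Longrightarrow> j \<in> B \<Longrightarrow> {i, j} \<notin> G" for A B
  proof -
    obtain v where v: "v \<in> A" using AB(4) by fastforce
    then have "A - {v} \<noteq> {}" using AB(4) by (auto simp: subset_singleton_iff)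
    then show ?thesis
      using AB v assms(2) by (intro Psi_tor_eq_0_if_split[OF assms(1), of v "A - {v}" B]) auto
  qed
  have "finite A" "finite B" using AB(1) by (metis finite_Un finite_atLeastAtMost)+
  then have "card A + card B = n" using AB(1,2) card_Un_disjoint[of A B] by simp
  \<comment> \<open>Two sides with at most one vertex each would give
    \<open>n \<le> 2\<close>.\<close>
  then consider "card A \<ge> 2" | "card B \<ge> 2" using * by linarith
  then show ?thesis
  proof cases
    case 1
    then show ?thesis using wlog[of A B] AB by blast
  next
    case 2
    then show ?thesis using wlog[of B A] AB by (metis Un_commute inf_commute insert_commute)
  qed
next
  assume "\<exists>v. cut_vertex {1..n} G v"
  then obtain v where v: "cut_vertex {1..n} G v" ..
  then have "\<not> graph_connected ({1..n} - {v}) G" by (intro cut_vertex_not_connected) auto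
  then obtain A B where "A \<union> B = {1..n} - {v}" "A \<inter> B = {}" "A \<noteq> {}" "B \<noteq> {}"
    "\<And>i j. i \<in> A \<Longrightarrow> j \<in> B \<Longrightarrow> {i, j} \<notin> G"
    using not_connected_split by metis
  then show ?thesis
    using v assms(1,2) by (intro Psi_tor_eq_0_if_split[of P n v A B]) (auto simp: cut_vertex_def)
qed

end
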